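(* Let $G$ be a group such that $x\otimes x=1_\otimes$ in $G\otimes G$ for all $x\in G$. If $A^\otimes(G)$ is the identity subgroup of $\mathrm{Aut}(G)$, i.e. $A^\otimes(G)=\{\mathrm{id}_G\}$, then $R_2^\otimes(G)=Z(G)$, where $Z(G)$ is the center of $G$.
   Context: Conventions: $g^h=h^{-1}gh$ and $[g,h]=g^{-1}h^{-1}gh$. For a group $G$, the non-abelian tensor square $G\otimes G$ is the group generated by symbols $g\otimes h$ ($g,h\in G$) subject to the relations $gg'\otimes h=(g^{g'}\otimes h^{g'})(g'\otimes h)$ and $g\otimes hh'=(g\otimes h')(g^{h'}\otimes h^{h'})$ for all $g,g',h,h'\in G$; its identity is $1_\otimes$. $A^\otimes(G)$ is the set of tensor commuting automorphisms of $G$: those $\alpha\in \mathrm{Aut}(G)$ with $x\otimes\alpha(x)=1_\otimes$ for all $x\in G$. $R_2^\otimes(G)=\{g\in G : [g,x]\otimes x=1_\otimes \text{ for all } x\in G\}$ (the right $2_\otimes$-Engel elements). *)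

theory Defs
  imports "HOL-Algebra.Algebra"
begin

section \<open>Groups given by generators and relations\<close>

text \<open>
  A word is a list of letters: \<open>(s, False)\<close> stands for the generator \<open>s\<close> and \<open>(s, True)\<close> for
  its formal inverse.
\<close>

type_synonym 'a word = "('a \<times> bool) list"

definition words :: "'a set \<Rightarrow> 'a word set" where
  "words S = lists (S \<times> UNIV)"

text \<open>
  The least congruence on words over \<open>S\<close> that contains free cancellation and identifies \<open>u\<close>
  with \<open>v\<close> whenever \<open>(u, v) \<in> R\<close> (the relation \<open>u = v\<close>).
\<close>

inductive_set word_cong :: "'a set \<Rightarrow> ('a word \<times> 'a word) set \<Rightarrow> ('a word \<times> 'a word) set"
  for S R where
    refl: "u \<in> words S \<Longrightarrow> (u, u) \<in> word_cong S R"
  | sym: "(u, v) \<in> word_cong S R \<Longrightarrow> (v, u) \<in> word_cong S R"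
  | trans: "(u, v) \<in> word_cong S R \<Longrightarrow> (v, w) \<in> word_cong S R \<Longrightarrow> (u, w) \<in> word_cong S R"
  | append: "(u, u') \<in> word_cong S R \<Longrightarrow> (v, v') \<in> word_cong S R
      \<Longrightarrow> (u @ v, u' @ v') \<in> word_cong S R"
  | cancel: "s \<in> S \<Longrightarrow> ([(s, b), (s, \<not> b)], []) \<in> word_cong S R"
  | relation: "(u, v) \<in> R \<Longrightarrow> u \<in> words S \<Longrightarrow> v \<in> words S \<Longrightarrow> (u, v) \<in> word_cong S R"

definition presented_group :: "'a set \<Rightarrow> ('a word \<times> 'a word) set \<Rightarrow> 'a word set monoid" where
  "presented_group S R =
    \<lparr>carrier = words S // word_cong S R,
     monoid.mult = (\<lambda>A B. \<Union>u\<in>A. \<Union>v\<in>B. word_cong S R `` {u @ v}),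
     one = word_cong S R `` {[]}\<rparr>"

lemma words_append [simp]: "u @ v \<in> words S \<longleftrightarrow> u \<in> words S \<and> v \<in> words S"
  by (simp add: words_def)

lemma words_Nil [simp]: "[] \<in> words S"
  by (simp add: words_def)

lemma words_Cons [simp]: "x # u \<in> words S \<longleftrightarrow> fst x \<in> S \<and> u \<in> words S"
  by (cases x) (auto simp: words_def)

lemma word_cong_words: "(u, v) \<in> word_cong S R \<Longrightarrow> u \<in> words S \<and> v \<in> words S"
  by (induction rule: word_cong.induct) auto

lemma equiv_word_cong: "equiv (words S) (word_cong S R)"
  by (rule equivI)
    (auto intro!: refl_onI symI transI dest: word_cong_words
       intro: word_cong.refl word_cong.sym word_cong.trans)

lemma word_class_eq_iff:
  "u \<in> words S \<Longrightarrow> v \<in> words S \<Longrightarrow>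
    word_cong S R `` {u} = word_cong S R `` {v} \<longleftrightarrow> (u, v) \<in> word_cong S R"
  by (rule eq_equiv_class_iff[OF equiv_word_cong])

lemma word_class_in_carrier:
  "u \<in> words S \<Longrightarrow> word_cong S R `` {u} \<in> carrier (presented_group S R)"
  by (simp add: presented_group_def quotientI)

lemma presented_group_carrierE:
  assumes "A \<in> carrier (presented_group S R)"
  obtains u where "u \<in> words S" "A = word_cong S R `` {u}"
  using assms by (auto simp: presented_group_def elim: quotientE)

lemma presented_group_mult:
  assumes "u \<in> words S" "v \<in> words S"
  shows "word_cong S R `` {u} \<otimes>\<^bsub>presented_group S R\<^esub> word_cong S R `` {v}
    = word_cong S R `` {u @ v}"
proof -
  have "congruent2 (word_cong S R) (word_cong S R) (\<lambda>u v. word_cong S R `` {u @ v})"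
    by (rule congruent2I'[of "word_cong S R" "word_cong S R"])
      (metis word_class_eq_iff word_cong.append word_cong_words words_append)
  from UN_equiv_class2[OF equiv_word_cong equiv_word_cong this assms] show ?thesis
    by (simp add: presented_group_def)
qed

lemma word_inverse: "u \<in> words S \<Longrightarrow> \<exists>v \<in> words S. (v @ u, []) \<in> word_cong S R"
proof (induction u)
  case Nil
  have "([] @ [], []) \<in> word_cong S R"
    by (simp add: word_cong.refl)
  then show ?case
    by (metis words_Nil)
next
  case (Cons x u)
  obtain s b where x: "x = (s, b)"
    by fastforce
  have s: "s \<in> S" "u \<in> words S"
    using Cons.prems x by auto
  obtain v where v: "v \<in> words S" "(v @ u, []) \<in> word_cong S R"
    using Cons.IH s by blast
  have "([(s, \<not> b), (s, b)] @ u, [] @ u) \<in> word_cong S R"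
    using word_cong.append[OF word_cong.cancel[of s S "\<not> b" R] word_cong.refl[of u S R]] s
    by simp
  from word_cong.append[OF word_cong.refl[OF v(1)] this]
  have "((v @ [(s, \<not> b)]) @ x # u, v @ u) \<in> word_cong S R"
    by (simp add: x)
  then have "((v @ [(s, \<not> b)]) @ x # u, []) \<in> word_cong S R"
    using v(2) word_cong.trans by metis
  then show ?case
    using v(1) s by (metis fst_conv words_Cons words_Nil words_append)
qed

lemma group_presented_group: "group (presented_group S R)"
proof (rule groupI)
  have one: "\<one>\<^bsub>presented_group S R\<^esub> = word_cong S R `` {[]}"
    by (simp add: presented_group_def)
  then show "\<one>\<^bsub>presented_group S R\<^esub> \<in> carrier (presented_group S R)"
    by (simp add: word_class_in_carrier)
  fix A assume A: "A \<in> carrier (presented_group S R)"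
  then obtain u where u: "u \<in> words S" "A = word_cong S R `` {u}"
    by (rule presented_group_carrierE)
  show "\<one>\<^bsub>presented_group S R\<^esub> \<otimes>\<^bsub>presented_group S R\<^esub> A = A"
    unfolding one u(2) using u(1) by (simp add: presented_group_mult)
  obtain v where v: "v \<in> words S" "(v @ u, []) \<in> word_cong S R"
    using word_inverse[OF u(1)] by blast
  have "word_cong S R `` {v} \<otimes>\<^bsub>presented_group S R\<^esub> A = \<one>\<^bsub>presented_group S R\<^esub>"
    unfolding one u(2) using u(1) v by (simp add: presented_group_mult word_class_eq_iff)
  then show "\<exists>B\<in>carrier (presented_group S R).
      B \<otimes>\<^bsub>presented_group S R\<^esub> A = \<one>\<^bsub>presented_group S R\<^esub>"
    using word_class_in_carrier[OF v(1)] by blast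
  fix B assume B: "B \<in> carrier (presented_group S R)"
  then obtain v where v: "v \<in> words S" "B = word_cong S R `` {v}"
    by (rule presented_group_carrierE)
  show "A \<otimes>\<^bsub>presented_group S R\<^esub> B \<in> carrier (presented_group S R)"
    using u v by (simp add: presented_group_mult word_class_in_carrier)
  fix C assume C: "C \<in> carrier (presented_group S R)"
  then obtain w where "w \<in> words S" "C = word_cong S R `` {w}"
    by (rule presented_group_carrierE)
  then show "A \<otimes>\<^bsub>presented_group S R\<^esub> B \<otimes>\<^bsub>presented_group S R\<^esub> C
      = A \<otimes>\<^bsub>presented_group S R\<^esub> (B \<otimes>\<^bsub>presented_group S R\<^esub> C)"
    using u v by (simp add: presented_group_mult)
qed


section \<open>The non-abelian tensor square\<close>

definition conjugate :: "('a, 'm) monoid_scheme \<Rightarrow> 'a \<Rightarrow> 'a \<Rightarrow> 'a" where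
  "conjugate G g h = inv\<^bsub>G\<^esub> h \<otimes>\<^bsub>G\<^esub> g \<otimes>\<^bsub>G\<^esub> h"

definition commutator :: "('a, 'm) monoid_scheme \<Rightarrow> 'a \<Rightarrow> 'a \<Rightarrow> 'a" where
  "commutator G g h = inv\<^bsub>G\<^esub> g \<otimes>\<^bsub>G\<^esub> inv\<^bsub>G\<^esub> h \<otimes>\<^bsub>G\<^esub> g \<otimes>\<^bsub>G\<^esub> h"

text \<open>
  The generating symbol of \<open>g\<close> and \<open>h\<close> is the pair \<open>(g, h)\<close>. The two families below are
  \<open>gg' \<otimes> h = (g^g' \<otimes> h^g')(g' \<otimes> h)\<close> and \<open>g \<otimes> hh' = (g \<otimes> h')(g^h' \<otimes> h^h')\<close>.
\<close>

definition tensor_relations ::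
    "('a, 'm) monoid_scheme \<Rightarrow> (('a \<times> 'a) word \<times> ('a \<times> 'a) word) set" where
  "tensor_relations G =
    {([((g \<otimes>\<^bsub>G\<^esub> g', h), False)],
      [((conjugate G g g', conjugate G h g'), False), ((g', h), False)]) | g g' h.
        g \<in> carrier G \<and> g' \<in> carrier G \<and> h \<in> carrier G} \<union>
    {([((g, h \<otimes>\<^bsub>G\<^esub> h'), False)],
      [((g, h'), False), ((conjugate G g h', conjugate G h h'), False)]) | g h h'.
        g \<in> carrier G \<and> h \<in> carrier G \<and> h' \<in> carrier G}"

definition tensor_square :: "('a, 'm) monoid_scheme \<Rightarrow> ('a \<times> 'a) word set monoid" where
  "tensor_square G = presented_group (carrier G \<times> carrier G) (tensor_relations G)"

definition tensor :: "('a, 'm) monoid_scheme \<Rightarrow> 'a \<Rightarrow> 'a \<Rightarrow> ('a \<times> 'a) word set" where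
  "tensor G g h = word_cong (carrier G \<times> carrier G) (tensor_relations G) `` {[((g, h), False)]}"

lemma group_tensor_square: "group (tensor_square G)"
  by (simp add: tensor_square_def group_presented_group)

lemma tensor_closed:
  "g \<in> carrier G \<Longrightarrow> h \<in> carrier G \<Longrightarrow> tensor G g h \<in> carrier (tensor_square G)"
  by (simp add: tensor_def tensor_square_def word_class_in_carrier)

lemma (in group) tensor_mult_left:
  assumes "g \<in> carrier G" "g' \<in> carrier G" "h \<in> carrier G"
  shows "tensor G (g \<otimes> g') h =
    tensor G (conjugate G g g') (conjugate G h g') \<otimes>\<^bsub>tensor_square G\<^esub> tensor G g' h"
proof -
  have "([((g \<otimes> g', h), False)],
      [((conjugate G g g', conjugate G h g'), False), ((g', h), False)]) \<in> tensor_relations G"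
    using assms by (auto simp: tensor_relations_def)
  then show ?thesis
    unfolding tensor_def tensor_square_def using assms
    by (subst presented_group_mult)
      (auto simp: word_class_eq_iff conjugate_def intro!: word_cong.relation)
qed

lemma (in group) tensor_mult_right:
  assumes "g \<in> carrier G" "h \<in> carrier G" "h' \<in> carrier G"
  shows "tensor G g (h \<otimes> h') =
    tensor G g h' \<otimes>\<^bsub>tensor_square G\<^esub> tensor G (conjugate G g h') (conjugate G h h')"
proof -
  have "([((g, h \<otimes> h'), False)],
      [((g, h'), False), ((conjugate G g h', conjugate G h h'), False)]) \<in> tensor_relations G"
    using assms by (auto simp: tensor_relations_def)
  then show ?thesis
    unfolding tensor_def tensor_square_def using assms
    by (subst presented_group_mult)
      (auto simp: word_class_eq_iff conjugate_def intro!: word_cong.relation)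
qed


section \<open>Tensor commuting automorphisms, Engel elements, center\<close>

definition tensor_commuting_autos :: "('a, 'm) monoid_scheme \<Rightarrow> ('a \<Rightarrow> 'a) set" where
  "tensor_commuting_autos G =
    {\<alpha> \<in> carrier (AutoGroup G). \<forall>x\<in>carrier G. tensor G x (\<alpha> x) = \<one>\<^bsub>tensor_square G\<^esub>}"

definition right_2_tensor_Engel :: "('a, 'm) monoid_scheme \<Rightarrow> 'a set" where
  "right_2_tensor_Engel G =
    {g \<in> carrier G. \<forall>x\<in>carrier G. tensor G (commutator G g x) x = \<one>\<^bsub>tensor_square G\<^esub>}"

definition group_center :: "('a, 'm) monoid_scheme \<Rightarrow> 'a set" where
  "group_center G = {z \<in> carrier G. \<forall>x\<in>carrier G. z \<otimes>\<^bsub>G\<^esub> x = x \<otimes>\<^bsub>G\<^esub> z}"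

end

theory Submission
  imports Defs
begin

text \<open>
  Expanding \<open>(xy) \<otimes> (xy) = 1\<close> gives \<open>(x^y \<otimes> y)(y \<otimes> x^y) = 1\<close>, so the tensor is antisymmetric.
  If \<open>g\<close> is a right \<open>2\<close>-tensor Engel element and \<open>c = [g, x]\<close>, then \<open>c \<otimes> x = 1\<close>; the commutator
  map \<open>G \<otimes> G \<rightarrow> G\<close> shows that \<open>c\<close> and \<open>x\<close> commute, whence \<open>c\<inverse> \<otimes> x = 1\<close> and \<open>x \<otimes> c\<inverse> = 1\<close>.
  As \<open>x^g = x c\<inverse>\<close>, conjugation by \<open>g\<close> is tensor commuting, hence trivial, and \<open>g\<close> is central.
\<close>

section \<open>Evaluating words in a group\<close>

definition (in group) eval_letter :: "('s \<Rightarrow> 'a) \<Rightarrow> 's \<times> bool \<Rightarrow> 'a" where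
  "eval_letter f l = (if snd l then inv (f (fst l)) else f (fst l))"

definition (in group) eval_word :: "('s \<Rightarrow> 'a) \<Rightarrow> 's word \<Rightarrow> 'a" where
  "eval_word f w = foldr (\<otimes>) (map (eval_letter f) w) \<one>"

context group
begin

lemma eval_word_Nil [simp]: "eval_word f [] = \<one>"
  by (simp add: eval_word_def)

lemma eval_word_Cons [simp]: "eval_word f (l # w) = eval_letter f l \<otimes> eval_word f w"
  by (simp add: eval_word_def)

lemma eval_letter_closed: "f \<in> S \<rightarrow> carrier G \<Longrightarrow> fst l \<in> S \<Longrightarrow> eval_letter f l \<in> carrier G"
  by (auto simp: eval_letter_def)

lemma eval_word_closed: "f \<in> S \<rightarrow> carrier G \<Longrightarrow> w \<in> words S \<Longrightarrow> eval_word f w \<in> carrier G"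
  by (induction w) (auto intro: eval_letter_closed)

lemma eval_word_append:
  assumes "f \<in> S \<rightarrow> carrier G" "u \<in> words S" "v \<in> words S"
  shows "eval_word f (u @ v) = eval_word f u \<otimes> eval_word f v"
  using assms(2)
  by (induction u) (use assms in \<open>auto simp: m_assoc eval_word_closed eval_letter_closed\<close>)

text \<open>Universal property of a presentation (von Dyck): an assignment of generators that
  respects the relations induces a homomorphism from the presented group to
  \<open>G\<close>.\<close>

lemma eval_word_cong:
  assumes f: "f \<in> S \<rightarrow> carrier G"
    and rel: "\<And>u v. (u, v) \<in> R \<Longrightarrow> u \<in> words S \<Longrightarrow> v \<in> words S \<Longrightarrow> eval_word f u = eval_word f v"
    and "(u, v) \<in> word_cong S R"
  shows "eval_word f u = eval_word f v"
  using assms(3)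
proof (induction rule: word_cong.induct)
  case (append u u' v v')
  then show ?case
    using eval_word_append[OF f] word_cong_words by metis
next
  case (cancel s b)
  then have "f s \<in> carrier G"
    using f by auto
  then show ?case
    by (simp add: eval_letter_def)
qed (use rel in auto)

text \<open>After reassociation to the right, an element and its inverse may meet only across a
  longer product; these rules cancel them there.\<close>

lemma mult_inv_cancel:
  assumes "x \<in> carrier G" "y \<in> carrier G"
  shows "x \<otimes> (inv x \<otimes> y) = y" "inv x \<otimes> (x \<otimes> y) = y"
  using assms by (simp_all flip: m_assoc)

lemmas group_normalize = m_assoc inv_mult_group mult_inv_cancel

section \<open>Conjugates and commutators\<close>

lemma conjugate_closed [simp]:
  "x \<in> carrier G \<Longrightarrow> y \<in> carrier G \<Longrightarrow> conjugate G x y \<in> carrier G"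
  by (simp add: conjugate_def)

lemma commutator_closed [simp]:
  "x \<in> carrier G \<Longrightarrow> y \<in> carrier G \<Longrightarrow> commutator G x y \<in> carrier G"
  by (simp add: commutator_def)

lemma conjugate_mult:
  "x \<in> carrier G \<Longrightarrow> y \<in> carrier G \<Longrightarrow> z \<in> carrier G \<Longrightarrow>
    conjugate G (x \<otimes> y) z = conjugate G x z \<otimes> conjugate G y z"
  by (simp add: conjugate_def group_normalize)

lemma conjugate_self: "x \<in> carrier G \<Longrightarrow> conjugate G x x = x"
  by (simp add: conjugate_def)

lemma conjugate_one [simp]: "x \<in> carrier G \<Longrightarrow> conjugate G x \<one> = x"
  by (simp add: conjugate_def)

lemma one_conjugate [simp]: "x \<in> carrier G \<Longrightarrow> conjugate G \<one> x = \<one>"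
  by (simp add: conjugate_def)

lemma conjugate_eq_self:
  "x \<in> carrier G \<Longrightarrow> y \<in> carrier G \<Longrightarrow> x \<otimes> y = y \<otimes> x \<Longrightarrow> conjugate G x y = x"
  by (simp add: conjugate_def group_normalize)

lemma conjugate_inv_conjugate:
  assumes "x \<in> carrier G" "y \<in> carrier G"
  shows "conjugate G (conjugate G x y) (inv y) = x" "conjugate G (conjugate G x (inv y)) y = x"
  using assms by (simp_all add: conjugate_def group_normalize)

lemma commutator_eq_one_iff:
  assumes "x \<in> carrier G" "y \<in> carrier G"
  shows "commutator G x y = \<one> \<longleftrightarrow> x \<otimes> y = y \<otimes> x"
proof -
  have "commutator G x y = inv (y \<otimes> x) \<otimes> (x \<otimes> y)"
    using assms by (simp add: commutator_def group_normalize)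
  then show ?thesis
    using assms by (metis inv_closed inv_equality inv_inv l_inv m_closed)
qed

text \<open>This and the next identity are the two tensor relations with commutators in place of
  tensors, as needed to map the tensor square to \<open>G\<close>.\<close>

lemma commutator_mult_left:
  assumes "g \<in> carrier G" "g' \<in> carrier G" "h \<in> carrier G"
  shows "commutator G (g \<otimes> g') h =
    commutator G (conjugate G g g') (conjugate G h g') \<otimes> commutator G g' h"
  using assms by (simp add: commutator_def conjugate_def group_normalize)

lemma commutator_mult_right:
  assumes "g \<in> carrier G" "h \<in> carrier G" "h' \<in> carrier G"
  shows "commutator G g (h \<otimes> h') =
    commutator G g h' \<otimes> commutator G (conjugate G g h') (conjugate G h h')"
  using assms by (simp add: commutator_def conjugate_def group_normalize)

text \<open>The map is restricted to the carrier because members of \<open>AutoGroup G\<close> are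
  extensional functions.\<close>

lemma conjugation_auto:
  assumes g: "g \<in> carrier G"
  shows "(\<lambda>x\<in>carrier G. conjugate G x g) \<in> carrier (AutoGroup G)"
proof -
  have "bij_betw (\<lambda>x\<in>carrier G. conjugate G x g) (carrier G) (carrier G)"
    by (rule bij_betw_byWitness[where f' = "\<lambda>x. conjugate G x (inv g)"])
      (use g in \<open>auto simp: conjugate_inv_conjugate\<close>)
  moreover have "(\<lambda>x\<in>carrier G. conjugate G x g) \<in> hom G G"
    using g by (auto simp: hom_def conjugate_mult)
  ultimately show ?thesis
    by (simp add: AutoGroup_def auto_def Bij_def)
qed

text \<open>The assignment of [g, h] to g \<otimes> h respects the defining relations, so a trivial
  tensor has a trivial commutator.\<close>

lemma tensor_eq_one_imp_commute:
  assumes x: "x \<in> carrier G" and y: "y \<in> carrier G"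
    and "tensor G x y = \<one>\<^bsub>tensor_square G\<^esub>"
  shows "x \<otimes> y = y \<otimes> x"
proof -
  let ?S = "carrier G \<times> carrier G" and ?f = "\<lambda>(g, h). commutator G g h"
  have "([((x, y), False)], []) \<in> word_cong ?S (tensor_relations G)"
    using assms(3) x y word_class_eq_iff[of "[((x, y), False)]" ?S "[]"]
    by (simp add: tensor_def tensor_square_def presented_group_def)
  then have "eval_word ?f [((x, y), False)] = eval_word ?f []"
  proof (rule eval_word_cong[rotated 2])
    fix u v assume "(u, v) \<in> tensor_relations G"
    then show "eval_word ?f u = eval_word ?f v"
      unfolding tensor_relations_def
      by (auto simp: eval_letter_def commutator_mult_left commutator_mult_right)
  qed auto
  then show ?thesis
    using x y by (simp add: eval_letter_def commutator_eq_one_iff)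
qed

section \<open>Identities in the tensor square\<close>

lemma tensor_one_left:
  assumes "x \<in> carrier G"
  shows "tensor G \<one> x = \<one>\<^bsub>tensor_square G\<^esub>"
proof -
  interpret T: group "tensor_square G"
    by (rule group_tensor_square)
  \<comment> \<open>An idempotent of a group is its identity.\<close>
  have "tensor G \<one> x \<otimes>\<^bsub>tensor_square G\<^esub> tensor G \<one> x = tensor G \<one> x"
    using tensor_mult_left[of \<one> \<one> x] assms by simp
  then show ?thesis
    using assms by (simp add: tensor_closed)
qed

lemma tensor_antisym:
  assumes diag: "\<forall>x\<in>carrier G. tensor G x x = \<one>\<^bsub>tensor_square G\<^esub>"
    and x: "x \<in> carrier G" and y: "y \<in> carrier G"
  shows "tensor G x y \<otimes>\<^bsub>tensor_square G\<^esub> tensor G y x = \<one>\<^bsub>tensor_square G\<^esub>"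
proof -
  interpret T: group "tensor_square G"
    by (rule group_tensor_square)
  \<comment> \<open>Chosen so that z^y = x: expanding zy \<otimes> zy then leaves tensors in x and
    y.\<close>
  define z where "z = conjugate G x (inv y)"
  have z: "z \<in> carrier G" and zy: "conjugate G z y = x"
    using x y by (simp_all add: z_def conjugate_inv_conjugate)
  have "tensor G (z \<otimes> y) (z \<otimes> y) =
      tensor G x (x \<otimes> y) \<otimes>\<^bsub>tensor_square G\<^esub> tensor G y (z \<otimes> y)"
    using y z by (simp add: tensor_mult_left conjugate_mult conjugate_self zy)
  \<comment> \<open>The other factor, x^y \<otimes> x^y, is diagonal and hence trivial.\<close>
  also have "tensor G x (x \<otimes> y) = tensor G x y"
    using x y diag by (simp add: tensor_mult_right tensor_closed)
  also have "tensor G y (z \<otimes> y) = tensor G y x"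
    using x y z diag by (simp add: tensor_mult_right tensor_closed conjugate_self zy)
  finally show ?thesis
    using diag y z by simp
qed

lemma tensor_inv_left_eq_one:
  assumes "c \<in> carrier G" "x \<in> carrier G" and "tensor G c x = \<one>\<^bsub>tensor_square G\<^esub>"
  shows "tensor G (inv c) x = \<one>\<^bsub>tensor_square G\<^esub>"
proof -
  interpret T: group "tensor_square G"
    by (rule group_tensor_square)
  have "x \<otimes> c = c \<otimes> x"
    using tensor_eq_one_imp_commute[OF assms] by simp
  \<comment> \<open>Conjugation by c fixes both c^-1 and x, and the remaining factor c \<otimes> x
    is trivial.\<close>
  then have "tensor G (inv c \<otimes> c) x = tensor G (inv c) x"
    using assms tensor_mult_left[of "inv c" c x]
    by (simp add: conjugate_eq_self tensor_closed)
  then show ?thesis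
    using assms by (simp add: tensor_one_left)
qed

lemma Engel_conjugation_tensor_commuting:
  assumes diag: "\<forall>x\<in>carrier G. tensor G x x = \<one>\<^bsub>tensor_square G\<^esub>"
    and g: "g \<in> right_2_tensor_Engel G"
  shows "(\<lambda>x\<in>carrier G. conjugate G x g) \<in> tensor_commuting_autos G"
proof -
  interpret T: group "tensor_square G"
    by (rule group_tensor_square)
  have gG: "g \<in> carrier G"
    using g by (simp add: right_2_tensor_Engel_def)
  have "tensor G x (conjugate G x g) = \<one>\<^bsub>tensor_square G\<^esub>" if x: "x \<in> carrier G" for x
  proof -
    \<comment> \<open>This is [x, g], the element with x^g = xd.\<close>
    define d where "d = inv (commutator G g x)"
    have d: "d \<in> carrier G"
      using gG x by (simp add: d_def)
    have "tensor G d x = \<one>\<^bsub>tensor_square G\<^esub>"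
      unfolding d_def using g gG x
      by (intro tensor_inv_left_eq_one) (auto simp: right_2_tensor_Engel_def)
    then have "tensor G x d = \<one>\<^bsub>tensor_square G\<^esub>"
      using tensor_antisym[OF diag x d] d x by (simp add: tensor_closed)
    moreover have "conjugate G x g = x \<otimes> d"
      using gG x by (simp add: d_def conjugate_def commutator_def group_normalize)
    \<comment> \<open>Expanding x \<otimes> xd gives x \<otimes> d times the diagonal tensor of x^d;
      both are trivial.\<close>
    ultimately show ?thesis
      using diag d x by (simp add: tensor_mult_right)
  qed
  then show ?thesis
    using gG by (simp add: tensor_commuting_autos_def conjugation_auto)
qed

text \<open>For central z every [z, x] is 1, and 1 \<otimes> x is trivial.\<close>

lemma group_center_subset_Engel: "group_center G \<subseteq> right_2_tensor_Engel G"
proof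
  fix z assume z: "z \<in> group_center G"
  then have "commutator G z x = \<one>" if "x \<in> carrier G" for x
    using that by (simp add: group_center_def commutator_eq_one_iff)
  then show "z \<in> right_2_tensor_Engel G"
    using z by (simp add: group_center_def right_2_tensor_Engel_def tensor_one_left)
qed

end

theorem corollary2p7:
  fixes G :: "('a, 'm) monoid_scheme" (structure)
  assumes "group G"
    and "\<forall>x\<in>carrier G. tensor G x x = \<one>\<^bsub>tensor_square G\<^esub>"
    and "tensor_commuting_autos G = {\<one>\<^bsub>AutoGroup G\<^esub>}"
  shows "right_2_tensor_Engel G = group_center G"
proof
  interpret group G by fact
  show "group_center G \<subseteq> right_2_tensor_Engel G"
    by (rule group_center_subset_Engel)
  show "right_2_tensor_Engel G \<subseteq> group_center G"
  proof
    fix g assume g: "g \<in> right_2_tensor_Engel G"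
    then have gG: "g \<in> carrier G"
      by (simp add: right_2_tensor_Engel_def)
    \<comment> \<open>Conjugation by g is tensor commuting, and the identity is the only such
      automorphism.\<close>
    have "(\<lambda>x\<in>carrier G. conjugate G x g) = \<one>\<^bsub>AutoGroup G\<^esub>"
      using Engel_conjugation_tensor_commuting[OF assms(2) g] assms(3) by simp
    then have conj: "(\<lambda>x\<in>carrier G. conjugate G x g) = (\<lambda>x\<in>carrier G. x)"
      by (simp add: AutoGroup_def BijGroup_def)
    have "g \<otimes> x = x \<otimes> g" if x: "x \<in> carrier G" for x
    proof -
      have "conjugate G x g = x"
        using fun_cong[OF conj, of x] x by simp
      then have "g \<otimes> x = g \<otimes> conjugate G x g"
        by simp
      also have "\<dots> = x \<otimes> g"
        using gG x by (simp add: conjugate_def group_normalize)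
      finally show ?thesis .
    qed
    then show "g \<in> group_center G"
      using gG by (simp add: group_center_def)
  qed
qed

end
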